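(* Let $a,b\in\mathbb{R}$ with $0<a<b$. For all $q\ge 1$, $p$ with $\frac1p+\frac1q=1$, and $n\in\mathbb{N}$ with $n>2$, put $$S=\sum_{i=1}^{2}\left[\left(\frac{q+3}{q+1}\right)^{i-1}b^{(n-2)q}+\left(\frac{q+3}{q+1}\right)^{2-i}a^{(n-2)q}\right]^{\frac1q}.$$ Then $$\left|A^n(a,b)-L_n^n(a,b)\right|\le\frac{n(n-1)(b-a)^2}{16}\left(\frac1{p+1}\right)^{\frac1p}\left(\frac1{2(q+2)}\right)^{\frac1q}S,$$ $$\left|A(a^n,b^n)-L_n^n(a,b)\right|\le\frac{n(n-1)(b-a)^2}{16}\left(\frac{2^{p+1}-1}{p+1}\right)^{\frac1p}\left(\frac1{2(q+2)}\right)^{\frac1q}S,$$ and $$\left|\tfrac13A(a^n,b^n)+\tfrac23A^n(a,b)-L_n^n(a,b)\right|\le\frac{n(n-1)(b-a)^2}{48}\left(\frac{2^{p+1}-1}{3(p+1)}\right)^{\frac1p}\left(\frac1{2(q+2)}\right)^{\frac1q}S.$$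
   Context: For positive $x,y$: $A(x,y)=\frac{x+y}{2}$ (arithmetic mean), and $A^n(a,b)=(A(a,b))^n$. For $0<a<b$, $L_n(a,b)=\left[\frac{b^{n+1}-a^{n+1}}{(n+1)(b-a)}\right]^{\frac1n}$ is the $n$-logarithmic mean, and $L_n^n(a,b)=(L_n(a,b))^n$. *)

theory Defs
  imports "HOL-Analysis.Analysis" "HOL-Real_Asymp.Real_Asymp"
begin

definition arith_mean :: "real \<Rightarrow> real \<Rightarrow> real" where
  "arith_mean x y = (x + y) / 2"

definition log_mean :: "nat \<Rightarrow> real \<Rightarrow> real \<Rightarrow> real" where
  "log_mean n a b =
     ((b ^ (n + 1) - a ^ (n + 1)) / (real (n + 1) * (b - a))) powr (1 / real n)"

text \<open>
  The exponent conjugate to 1 is infinite.  Conjugate exponents are therefore taken in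
  \<^typ>\<open>ennreal\<close>, where 1 / 0 is infinite and 1 / \<open>\<infinity>\<close> is 0 (over \<^typ>\<open>real\<close> the convention
  1 / 0 = 0 would make 0 conjugate to 1), and an expression in the exponent is read at
  \<open>\<infinity>\<close> as its limit.
\<close>

definition at_exponent :: "(real \<Rightarrow> real) \<Rightarrow> ennreal \<Rightarrow> real" where
  "at_exponent C p = (if p = \<infinity> then Lim at_top C else C (enn2real p))"

lemma at_exponent_ennreal: "r \<ge> 0 \<Longrightarrow> at_exponent C (ennreal r) = C r"
  by (simp add: at_exponent_def)

lemma at_exponent_top: "(C \<longlongrightarrow> c) at_top \<Longrightarrow> at_exponent C \<infinity> = c"
  by (simp add: at_exponent_def tendsto_Lim)

lemma at_exponent_top_values:
  "at_exponent (\<lambda>p. (1 / (p + 1)) powr (1 / p)) \<infinity> = 1"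
  "at_exponent (\<lambda>p. ((2 powr (p + 1) - 1) / (p + 1)) powr (1 / p)) \<infinity> = 2"
  "at_exponent (\<lambda>p. ((2 powr (p + 1) - 1) / (3 * (p + 1))) powr (1 / p)) \<infinity> = 2"
  by (rule at_exponent_top, real_asymp)+

lemma conjugate_exponent_real_iff:
  fixes p q :: real
  assumes "p > 0" "q \<ge> 1"
  shows "1 / ennreal p + 1 / ennreal q = 1 \<longleftrightarrow> 1 / p + 1 / q = 1"
proof -
  have "1 / ennreal p + 1 / ennreal q = ennreal (1 / p + 1 / q)"
    using assms by (simp add: divide_ennreal flip: ennreal_1 ennreal_plus)
  then show ?thesis
    using assms by (simp add: ennreal_eq_1 del: ennreal_plus)
qed

lemma conjugate_exponent_one_iff: "1 / p + 1 / ennreal 1 = 1 \<longleftrightarrow> p = \<infinity>"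
proof
  assume *: "1 / p + 1 / ennreal 1 = 1"
  have "inverse p = (1 / p + 1 / ennreal 1) - 1"
    by (simp add: divide_ennreal_def)
  then show "p = \<infinity>"
    using * by simp
qed (simp add: divide_ennreal_def)

end

theory Submission
  imports Defs
begin

text \<open>
  Apply three quadrature rules to \<open>x\<^sup>n\<close> on \<open>[a, b]\<close>, whose mean value is \<open>L\<^sub>n\<^sup>n\<close>.  On each of
  the two halves of the interval, parametrised by \<open>t \<in> [0, 1]\<close> from the endpoint to the
  midpoint, the error is an integral of the second derivative against a kernel \<open>t (c + d t)\<close>:
  \<open>t\<^sup>2\<close> for the midpoint rule, \<open>t (2 - t)\<close> for the trapezoidal rule and \<open>t (2 - 3 t)\<close> for
  Simpson's rule.  Convexity of \<open>x powr ((n - 2) q)\<close> bounds the \<open>q\<close>-th power of the second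
  derivative by its chord.  For the first two rules, Hoelder's inequality applied to
  \<open>\<bar>c + d t\<bar>\<close> and \<open>t x\<^sup>n\<^sup>-\<^sup>2\<close> gives the claim.

  For Simpson's rule Hoelder's inequality only gives the larger constant
  \<open>(2 powr (p + 1) + 1) / (3 (p + 1))\<close>, since \<open>2 - 3 t\<close> changes sign.  There the power mean
  inequality with weight \<open>t \<bar>2 - 3 t\<bar>\<close> of total mass 8/27 does better: it yields the constant
  \<open>(1/2) powr (1/p)\<close>, and \<open>(2 powr (p + 1) - 1) / (3 (p + 1)) \<ge> 1/2\<close>.
\<close>

section \<open>Integral inequalities of Hoelder and power mean type\<close>

lemma Holder_integral:
  fixes f g :: "real \<Rightarrow> real" and p q :: real
  assumes "p > 1" "q > 1" "1 / p + 1 / q = 1"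
    and "\<And>x. x \<in> S \<Longrightarrow> f x \<ge> 0" "\<And>x. x \<in> S \<Longrightarrow> g x \<ge> 0"
    and fg: "((\<lambda>x. f x * g x) has_integral I) S"
    and fp: "((\<lambda>x. f x powr p) has_integral A) S" and "A > 0"
    and gq: "((\<lambda>x. g x powr q) has_integral B) S" and "B > 0"
  shows "I \<le> A powr (1 / p) * B powr (1 / q)"
proof -
  define c where "c = A powr (1 / p)"
  define d where "d = B powr (1 / q)"
  have pos: "c > 0" "d > 0"
    using assms by (auto simp: c_def d_def)
  have cd: "c powr p = A" "d powr q = B"
    using assms by (auto simp: c_def d_def powr_powr)
  have "((\<lambda>x. c * d * (f x powr p / A / p + g x powr q / B / q)) has_integral
          c * d * (A / A / p + B / B / q)) S"
    by (intro has_integral_mult_right has_integral_add has_integral_divide fp gq)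
  moreover have "f x * g x \<le> c * d * (f x powr p / A / p + g x powr q / B / q)" if "x \<in> S" for x
  proof -
    \<comment> \<open>Young's inequality for \<open>f\<close> and \<open>g\<close> normalised by
      their norms \<open>c\<close> and \<open>d\<close>; after integration the two terms on the
      right become \<open>1 / p\<close> and \<open>1 / q\<close>.\<close>
    have "(f x / c) * (g x / d) \<le> (f x / c) powr p / p + (g x / d) powr q / q"
      using assms that pos by (intro Youngs_inequality) auto
    also have "\<dots> = f x powr p / A / p + g x powr q / B / q"
      using assms that pos by (simp add: powr_divide cd)
    finally show ?thesis
      using pos by (simp add: field_simps)
  qed
  ultimately have "I \<le> c * d * (A / A / p + B / B / q)"
    using fg by (meson has_integral_le)
  then show ?thesis
    using assms by (simp add: c_def d_def)
qed

text \<open>This is Hoelder's inequality for the factors \<open>w powr (1 - 1 / q)\<close> and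
  \<open>w powr (1 / q) * g\<close>, with a direct proof that includes \<open>q = 1\<close>.\<close>

lemma power_mean_integral:
  fixes w g :: "real \<Rightarrow> real" and q :: real
  assumes "q \<ge> 1"
    and "\<And>x. x \<in> S \<Longrightarrow> w x \<ge> 0" "\<And>x. x \<in> S \<Longrightarrow> g x > 0"
    and wg: "((\<lambda>x. w x * g x) has_integral I) S"
    and w: "(w has_integral W) S" and "W > 0"
    and wgq: "((\<lambda>x. w x * g x powr q) has_integral B) S" and "B > 0"
  shows "I \<le> W powr (1 - 1 / q) * B powr (1 / q)"
proof -
  \<comment> \<open>Integrate the tangent line bound for \<open>z powr (1 / q)\<close> at \<open>z = B / W\<close>.\<close>
  define l where "l = (B / W) powr (1 / q)"
  have l: "l > 0"
    using assms by (auto simp: l_def)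
  have lq: "l powr q = B / W"
    using assms by (auto simp: l_def powr_powr)
  have "((\<lambda>x. (1 - 1 / q) * l * w x + l powr (1 - q) / q * (w x * g x powr q)) has_integral
          (1 - 1 / q) * l * W + l powr (1 - q) / q * B) S"
    by (intro has_integral_mult_right has_integral_add w wgq)
  moreover have "w x * g x \<le> (1 - 1 / q) * l * w x + l powr (1 - q) / q * (w x * g x powr q)"
    if "x \<in> S" for x
  proof -
    \<comment> \<open>The two arguments of the weighted AM-GM inequality are scaled so that their
      weighted geometric mean is exactly \<open>g x\<close>.\<close>
    have "l powr (1 - 1 / q) * (l powr (1 - q) * g x powr q) powr (1 / q)
        \<le> (1 - 1 / q) * l + 1 / q * (l powr (1 - q) * g x powr q)"
      using assms(1) assms(3)[OF that] l by (intro Youngs_inequality_0 mult_pos_pos) auto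
    also have "l powr (1 - 1 / q) * (l powr (1 - q) * g x powr q) powr (1 / q) =
       l powr ((1 - 1 / q) + (1 - q) / q) * g x"
      unfolding powr_add using assms(1) assms(3)[OF that] by (simp add: powr_mult powr_powr)
    also have "(1 - 1 / q) + (1 - q) / q = 0"
      using assms by (simp add: field_simps)
    finally show ?thesis
      using mult_left_mono[of "g x" "(1 - 1 / q) * l + 1 / q * (l powr (1 - q) * g x powr q)" "w x"]
        assms that l by (simp add: algebra_simps)
  qed
  ultimately have "I \<le> (1 - 1 / q) * l * W + l powr (1 - q) / q * B"
    using wg by (meson has_integral_le)
  also have "l powr (1 - q) = l * (W / B)"
    using l lq assms by (simp add: powr_diff)
  also have "(1 - 1 / q) * l * W + l * (W / B) / q * B = l * W"
    using assms by (simp add: field_simps)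
  also have "l * W = W powr (1 - 1 / q) * B powr (1 / q)"
    using assms by (simp add: l_def powr_divide powr_diff)
  finally show ?thesis .
qed

section \<open>Convexity bounds along a half interval\<close>

lemma chord_pos:
  fixes x y t :: real
  assumes "x > 0" "y > 0" "t \<in> {0..1}"
  shows "x + t * (y - x) / 2 > 0"
proof -
  have "(1 - t / 2) * x > 0" "t / 2 * y \<ge> 0"
    using assms by auto
  then show ?thesis
    by (simp add: field_simps)
qed

lemma chord_bound:
  fixes x y t q :: real and m :: nat
  assumes "x > 0" "y > 0" "q \<ge> 1" "m \<ge> 1" "t \<in> {0..1}"
  shows "((x + t * (y - x) / 2) ^ m) powr q
    \<le> (1 - t / 2) * x powr (real m * q) + t / 2 * y powr (real m * q)"
proof -
  have pos: "x + t * (y - x) / 2 > 0"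
    using assms by (intro chord_pos)
  have "real m * q \<ge> 1"
    using assms mult_mono[of 1 "real m" 1 q] by simp
  from convex_onD[OF powr_convex[OF this], of "t / 2" x y]
  have "((1 - t / 2) * x + t / 2 * y) powr (real m * q)
    \<le> (1 - t / 2) * x powr (real m * q) + t / 2 * y powr (real m * q)"
    using assms by simp
  moreover have "(1 - t / 2) * x + t / 2 * y = x + t * (y - x) / 2"
    by (simp add: field_simps)
  moreover have "((x + t * (y - x) / 2) ^ m) powr q = (x + t * (y - x) / 2) powr (real m * q)"
    using pos by (simp add: powr_powr flip: powr_realpow)
  ultimately show ?thesis
    by simp
qed

text \<open>
  The integral of \<open>t powr q\<close> times the chord from \<open>x powr (m q)\<close> at \<open>t = 0\<close> to the mean of
  \<open>x powr (m q)\<close> and \<open>y powr (m q)\<close> at \<open>t = 1\<close>.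
\<close>

definition half_bound :: "real \<Rightarrow> nat \<Rightarrow> real \<Rightarrow> real \<Rightarrow> real" where
  "half_bound q m x y =
     1 / (2 * (q + 2)) * ((q + 3) / (q + 1) * x powr (real m * q) + y powr (real m * q))"

lemma half_bound_pos: "x > 0 \<Longrightarrow> y > 0 \<Longrightarrow> q \<ge> 1 \<Longrightarrow> half_bound q m x y > 0"
  unfolding half_bound_def by (intro mult_pos_pos add_pos_pos divide_pos_pos) auto

lemma integral_powr_chord_le:
  fixes x y q :: real and m :: nat
  assumes "x > 0" "y > 0" "q \<ge> 1" "m \<ge> 1"
    and I: "((\<lambda>t. (t * (x + t * (y - x) / 2) ^ m) powr q) has_integral I) {0..1}"
  shows "I \<le> half_bound q m x y"
proof -
  define X where "X = x powr (real m * q)"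
  define Y where "Y = y powr (real m * q)"
  have "((\<lambda>t. t powr q * X + t powr (q + 1) * ((Y - X) / 2)) has_integral
          1 powr (q + 1) / (q + 1) * X + 1 powr (q + 1 + 1) / (q + 1 + 1) * ((Y - X) / 2)) {0..1}"
    using assms by (intro has_integral_add has_integral_mult_left has_integral_powr_from_0) auto
  moreover have "(t * (x + t * (y - x) / 2) ^ m) powr q
      \<le> t powr q * X + t powr (q + 1) * ((Y - X) / 2)" if "t \<in> {0..1}" for t
  proof -
    have "(t * (x + t * (y - x) / 2) ^ m) powr q
        \<le> t powr q * ((1 - t / 2) * X + t / 2 * Y)"
      unfolding powr_mult X_def Y_def
      by (intro mult_left_mono chord_bound assms that) auto
    also have "\<dots> = t powr q * X + t powr (q + 1) * ((Y - X) / 2)"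
      using that by (cases "t = 0") (auto simp: powr_add field_simps)
    finally show ?thesis .
  qed
  ultimately have "I \<le> 1 powr (q + 1) / (q + 1) * X + 1 powr (q + 1 + 1) / (q + 1 + 1) * ((Y - X) / 2)"
    using I by (meson has_integral_le)
  also have "\<dots> = half_bound q m x y"
    using assms unfolding half_bound_def X_def[symmetric] Y_def[symmetric]
    by (simp add: divide_simps) algebra
  finally show ?thesis .
qed

section \<open>Kernels with a Hoelder or supremum constant\<close>

lemma Holder_half_bound:
  fixes x y p q :: real and m :: nat
  assumes "x > 0" "y > 0" "p > 1" "q > 1" "1 / p + 1 / q = 1" "m \<ge> 1"
    and u: "continuous_on {0..1} u" "\<And>t. t \<in> {0..1} \<Longrightarrow> u t \<ge> 0"
    and A: "((\<lambda>t. u t powr p) has_integral A) {0..1}" "A > 0"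
  shows "integral {0..1} (\<lambda>t. t * u t * (x + t * (y - x) / 2) ^ m)
    \<le> A powr (1 / p) * half_bound q m x y powr (1 / q)"
proof -
  \<comment> \<open>The factor \<open>t\<close> of the kernel stays with the power of the chord
    point, so \<open>u\<close> alone determines the constant and the other norm is bounded by
    \<open>half_bound\<close>.\<close>
  define g where "g = (\<lambda>t. t * (x + t * (y - x) / 2) ^ m)"
  define B where "B = integral {0..1} (\<lambda>t. g t powr q)"
  have g0: "g t \<ge> 0" if "t \<in> {0..1}" for t
    using chord_pos[OF assms(1,2) that] that by (auto simp: g_def)
  have gc: "continuous_on {0..1} g"
    unfolding g_def by (intro continuous_intros) auto
  have gq: "((\<lambda>t. g t powr q) has_integral B) {0..1}"
    unfolding B_def using assms g0 gc
    by (intro integrable_integral integrable_continuous_interval continuous_on_powr' continuous_intros) auto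
  have B: "B \<le> half_bound q m x y"
    using integral_powr_chord_le[of x y q m B] assms gq by (auto simp: g_def)
  have "((\<lambda>t. u t * g t) has_integral integral {0..1} (\<lambda>t. u t * g t)) {0..1}"
    using gc u by (intro integrable_integral integrable_continuous_interval continuous_intros)
  moreover have "B > 0"
  proof -
    have "B \<ge> 0"
      using gq by (rule has_integral_nonneg) auto
    \<comment> \<open>A nonnegative continuous function with integral zero vanishes everywhere, but
      at \<open>t = 1\<close> the integrand is a power of the midpoint of \<open>x\<close> and
      \<open>y\<close>, hence positive.\<close>
    moreover have "B \<noteq> 0"
    proof
      assume "B = 0"
      then have "g 1 powr q = 0"
        using gq assms g0 gc
        by (intro has_integral_0_cbox_imp_0[of 0 1 "\<lambda>t. g t powr q"] continuous_on_powr' continuous_intros)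
          (auto simp: box_real)
      then show False
        using chord_pos[OF assms(1,2), of 1] by (auto simp: g_def)
    qed
    ultimately show ?thesis by simp
  qed
  ultimately have "integral {0..1} (\<lambda>t. u t * g t) \<le> A powr (1 / p) * B powr (1 / q)"
    using assms g0 gq by (intro Holder_integral[where f = u and g = g and S = "{0..1}"]) auto
  also have "\<dots> \<le> A powr (1 / p) * half_bound q m x y powr (1 / q)"
    using B \<open>B > 0\<close> assms by (intro mult_left_mono powr_mono2) auto
  finally show ?thesis
    by (simp add: g_def mult_ac)
qed

text \<open>The limiting case \<open>q = 1\<close>, \<open>p = \<infinity>\<close> of
  \<open>Holder_half_bound\<close>: the uniform bound \<open>K\<close> replaces the norm of
  \<open>u\<close>.\<close>

lemma sup_half_bound:
  fixes x y K :: real and m :: nat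
  assumes "x > 0" "y > 0" "m \<ge> 1"
    and u: "continuous_on {0..1} u" "\<And>t. t \<in> {0..1} \<Longrightarrow> u t \<le> K" and "K \<ge> 0"
  shows "integral {0..1} (\<lambda>t. t * u t * (x + t * (y - x) / 2) ^ m) \<le> K * half_bound 1 m x y"
proof -
  define g where "g = (\<lambda>t. t * (x + t * (y - x) / 2) ^ m)"
  have g0: "g t \<ge> 0" if "t \<in> {0..1}" for t
    using chord_pos[OF assms(1,2) that] that by (auto simp: g_def)
  have gc: "continuous_on {0..1} g"
    unfolding g_def by (intro continuous_intros) auto
  have "(g has_integral integral {0..1} g) {0..1}"
    using gc by (intro integrable_integral integrable_continuous_interval)
  then have "((\<lambda>t. g t powr 1) has_integral integral {0..1} g) {0..1}"
    by (rule has_integral_eq[rotated]) (use g0 in auto)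
  then have B: "integral {0..1} g \<le> half_bound 1 m x y"
    using integral_powr_chord_le[of x y 1 m] assms by (auto simp: g_def)
  have "integral {0..1} (\<lambda>t. u t * g t) \<le> integral {0..1} (\<lambda>t. K * g t)"
    using gc u g0 by (intro integral_le integrable_continuous_interval continuous_intros mult_right_mono)
  also have "\<dots> = K * integral {0..1} g"
    by simp
  also have "\<dots> \<le> K * half_bound 1 m x y"
    using B assms by (intro mult_left_mono)
  finally show ?thesis
    by (simp add: g_def mult_ac)
qed

section \<open>The Simpson kernel\<close>

lemma has_integral_simpson_weight:
  "((\<lambda>t. (t * \<bar>2 - 3 * t\<bar>) * (c + d * t)) has_integral 8 / 27 * c + 59 / 324 * d) {0..1::real}"
proof -
  let ?F = "\<lambda>t::real. c * (t\<^sup>2 - t ^ 3) + d * (2 / 3 * t ^ 3 - 3 / 4 * t ^ 4)"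
  let ?f = "\<lambda>t::real. t * (2 - 3 * t) * (c + d * t)"
  have F: "(?F has_vector_derivative ?f t) (at t within S)" for t S
    by (auto intro!: derivative_eq_intros simp: algebra_simps power2_eq_square power3_eq_cube
        simp flip: has_real_derivative_iff_has_vector_derivative)
  \<comment> \<open>The weight changes sign at \<open>t = 2/3\<close>, so the signed antiderivative
    is evaluated separately on the two sides.\<close>
  have "(?f has_integral ?F (2 / 3) - ?F 0) {0..2 / 3}"
    by (intro fundamental_theorem_of_calculus F) auto
  then have "((\<lambda>t. (t * \<bar>2 - 3 * t\<bar>) * (c + d * t)) has_integral ?F (2 / 3) - ?F 0) {0..2 / 3}"
    by (rule has_integral_eq[rotated]) auto
  moreover have "((\<lambda>t. - ?f t) has_integral - (?F 1 - ?F (2 / 3))) {2 / 3..1}"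
    by (intro has_integral_neg fundamental_theorem_of_calculus F) auto
  then have "((\<lambda>t. (t * \<bar>2 - 3 * t\<bar>) * (c + d * t)) has_integral - (?F 1 - ?F (2 / 3))) {2 / 3..1}"
    by (rule has_integral_eq[rotated]) (auto simp: algebra_simps)
  ultimately have "((\<lambda>t. (t * \<bar>2 - 3 * t\<bar>) * (c + d * t)) has_integral
      (?F (2 / 3) - ?F 0) + - (?F 1 - ?F (2 / 3))) {0..1}"
    by (intro has_integral_combine) auto
  also have "(?F (2 / 3) - ?F 0) + - (?F 1 - ?F (2 / 3)) = 8 / 27 * c + 59 / 324 * d"
    by (simp add: eval_nat_numeral field_simps)
  finally show ?thesis .
qed

text \<open>The whole kernel serves as the weight. Its mass 8/27 is below 1/2, and the surplus
  factor 16/27 pays for the decay of \<open>half_bound\<close> in \<open>q\<close>. Leaving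
  \<open>C\<close> free treats finite and infinite \<open>p\<close> together.\<close>

lemma simpson_half_bound:
  fixes x y q C :: real and m :: nat
  assumes "x > 0" "y > 0" "q \<ge> 1" "m \<ge> 1"
    and C: "C \<ge> (1 / 2) powr (1 - 1 / q)"
  shows "integral {0..1} (\<lambda>t. t * \<bar>2 - 3 * t\<bar> * (x + t * (y - x) / 2) ^ m)
    \<le> C * half_bound q m x y powr (1 / q)"
proof -
  define X where "X = x powr (real m * q)"
  define Y where "Y = y powr (real m * q)"
  have XY: "X > 0" "Y > 0"
    using assms by (auto simp: X_def Y_def)
  define w :: "real \<Rightarrow> real" where "w = (\<lambda>t. t * \<bar>2 - 3 * t\<bar>)"
  define g where "g = (\<lambda>t. (x + t * (y - x) / 2) ^ m)"
  define B where "B = integral {0..1} (\<lambda>t. w t * g t powr q)"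
  \<comment> \<open>The integral of the weight against the chord \<open>X + (Y - X) / 2 * t\<close>;
    here 133/648 is 8/27 - 59/648.\<close>
  define M where "M = 133 / 648 * X + 59 / 648 * Y"
  have g0: "g t > 0" if "t \<in> {0..1}" for t
    using chord_pos[OF assms(1,2) that] by (auto simp: g_def)
  have c: "continuous_on {0..1} g" "continuous_on {0..1} w"
    unfolding g_def w_def by (intro continuous_intros; simp)+
  have wg: "((\<lambda>t. w t * g t) has_integral integral {0..1} (\<lambda>t. w t * g t)) {0..1}"
    using c by (intro integrable_integral integrable_continuous_interval continuous_intros)
  have wgq: "((\<lambda>t. w t * g t powr q) has_integral B) {0..1}"
    unfolding B_def using c g0
    by (intro integrable_integral integrable_continuous_interval continuous_intros)
      (auto simp: less_imp_neq[THEN not_sym])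
  have w: "(w has_integral 8 / 27) {0..1}"
    using has_integral_simpson_weight[of 1 0] by (simp add: w_def)
  have B_le: "B \<le> M"
  proof -
    have "((\<lambda>t. w t * (X + (Y - X) / 2 * t)) has_integral M) {0..1}"
      using has_integral_simpson_weight[of X "(Y - X) / 2"]
      by (simp add: w_def M_def field_simps)
    then show ?thesis
    proof (rule has_integral_le[OF wgq])
      fix t :: real assume t: "t \<in> {0..1}"
      have "g t powr q \<le> (1 - t / 2) * X + t / 2 * Y"
        unfolding g_def X_def Y_def using chord_bound[OF assms(1-4) t] by simp
      also have "\<dots> = X + (Y - X) / 2 * t"
        by (simp add: field_simps)
      finally show "w t * g t powr q \<le> w t * (X + (Y - X) / 2 * t)"
        using t by (intro mult_left_mono) (auto simp: w_def)
    qed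
  qed
  have "B > 0"
  proof -
    have "B \<ge> 0"
      using wgq by (rule has_integral_nonneg) (auto simp: w_def)
    moreover have "B \<noteq> 0"
    proof
      assume "B = 0"
      then have "w 1 * g 1 powr q = 0"
        using wgq assms g0 c
        by (intro has_integral_0_cbox_imp_0[of 0 1 "\<lambda>t. w t * g t powr q"] continuous_intros)
          (force simp: box_real w_def)+
      then show False
        using g0[of 1] by (auto simp: w_def)
    qed
    ultimately show ?thesis by simp
  qed
  have M_le: "(16 / 27) powr (q - 1) * M \<le> half_bound q m x y"
  proof -
    \<comment> \<open>Since e is at most the square of 27/16, the bound
      \<open>1 + z \<le> exp z\<close> at \<open>z = (q - 1) * ln (27 / 16)\<close> gives
      \<open>(27 / 16) powr (q - 1) \<ge> (q + 1) / 2\<close>.\<close>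
    have "1 \<le> ln ((27 / 16 :: real)\<^sup>2)"
      using e_less_272 by (subst ln_ge_iff) (auto simp: power2_eq_square)
    then have "ln (27 / 16 :: real) \<ge> 1 / 2"
      by (subst (asm) ln_realpow) auto
    then have "(q - 1) * (1 / 2) \<le> (q - 1) * ln (27 / 16)"
      using assms by (intro mult_left_mono) auto
    also have "1 + (q - 1) * ln (27 / 16) \<le> exp ((q - 1) * ln (27 / 16 :: real))"
      by (rule exp_ge_add_one_self)
    also have "\<dots> = (27 / 16) powr (q - 1)"
      by (simp add: powr_def)
    finally have "(q + 1) / 2 \<le> (27 / 16) powr (q - 1)"
      by (simp add: field_simps)
    moreover have "(27 / 16 :: real) powr (q - 1) * (16 / 27) powr (q - 1) = 1"
      by (simp flip: powr_mult)
    ultimately have "(16 / 27 :: real) powr (q - 1) * ((q + 1) / 2) \<le> 1"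
      by (metis mult.commute mult_right_mono powr_ge_zero)
    then have s: "(16 / 27 :: real) powr (q - 1) \<le> 2 / (q + 1)"
      using assms by (simp add: field_simps)
    have "(16 / 27) powr (q - 1) * M \<le> 2 / (q + 1) * M"
      using XY by (intro mult_right_mono s) (auto simp: M_def)
    also have "\<dots> \<le> half_bound q m x y"
    proof -
      have "2 * M = 133 / 324 * X + 59 / 324 * Y"
        by (simp add: M_def)
      \<comment> \<open>For \<open>q \<ge> 1\<close> the coefficients on the right are at least 1/2
        and 1/3, well above 133/324 and 59/324.\<close>
      also have "\<dots> \<le> (q + 3) / (2 * (q + 2)) * X + (q + 1) / (2 * (q + 2)) * Y"
        using assms XY by (intro add_mono mult_right_mono) (auto simp: divide_simps)
      also have "\<dots> = (q + 1) * half_bound q m x y"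
        unfolding half_bound_def X_def[symmetric] Y_def[symmetric]
        using assms by (simp add: divide_simps)
      finally show ?thesis
        using assms by (simp add: field_simps)
    qed
    finally show ?thesis .
  qed
  have "integral {0..1} (\<lambda>t. w t * g t) \<le> (8 / 27) powr (1 - 1 / q) * B powr (1 / q)"
    using assms g0 wg w wgq \<open>B > 0\<close>
    by (intro power_mean_integral[where w = w and g = g and S = "{0..1}"]) (auto simp: w_def)
  also have "\<dots> \<le> (8 / 27) powr (1 - 1 / q) * M powr (1 / q)"
    using B_le \<open>B > 0\<close> assms by (intro mult_left_mono powr_mono2) auto
  \<comment> \<open>The factor 1/2 is left for \<open>C\<close>, while 16/27 moves under the
    \<open>q\<close>-th root to meet \<open>M_le\<close>.\<close>
  also have "(8 / 27) powr (1 - 1 / q) = (1 / 2) powr (1 - 1 / q) * (16 / 27 :: real) powr (1 - 1 / q)"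
    by (simp flip: powr_mult)
  also have "(16 / 27 :: real) powr (1 - 1 / q) = ((16 / 27) powr (q - 1)) powr (1 / q)"
    using assms by (simp add: powr_powr field_simps)
  also have "(1 / 2) powr (1 - 1 / q) * ((16 / 27) powr (q - 1)) powr (1 / q) * M powr (1 / q)
     = (1 / 2) powr (1 - 1 / q) * ((16 / 27) powr (q - 1) * M) powr (1 / q)"
    by (simp add: powr_mult)
  also have "\<dots> \<le> C * half_bound q m x y powr (1 / q)"
    using C M_le XY assms by (intro mult_mono powr_mono2) (auto simp: M_def intro: order_trans[rotated])
  finally show ?thesis
    by (simp add: g_def w_def)
qed

section \<open>Integral representation of the quadrature error\<close>

lemma has_integral_quadratic_kernel:
  fixes x h c d :: real and n :: nat
  assumes "n \<ge> 2" "h \<noteq> 0"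
  shows "((\<lambda>t. (c * t + d * t\<^sup>2) * (x + t * h) ^ (n - 2)) has_integral
    ((c + d) * (real n * (x + h) ^ (n - 1)) / h - ((c + 2 * d) * (x + h) ^ n - c * x ^ n) / h\<^sup>2
      + 2 * d * ((x + h) ^ (n + 1) - x ^ (n + 1)) / (real n + 1) / h ^ 3) / (real n * (real n - 1)))
    {0..1}"
proof -
  \<comment> \<open>Each \<open>G\<close> is an antiderivative of the preceding one; \<open>F\<close> is repeated integration by parts.\<close>
  define G1 where "G1 = (\<lambda>t. real n * (x + t * h) ^ (n - 1) / h)"
  define G2 where "G2 = (\<lambda>t. (x + t * h) ^ n / h\<^sup>2)"
  define G3 where "G3 = (\<lambda>t. (x + t * h) ^ (n + 1) / (real n + 1) / h ^ 3)"
  define N where "N = real n * (real n - 1)"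
  have "N \<noteq> 0"
    using assms by (auto simp: N_def)
  define F where "F = (\<lambda>t. ((c * t + d * t\<^sup>2) * G1 t - (c + 2 * d * t) * G2 t + 2 * d * G3 t) / N)"
  obtain m where n: "n = Suc (Suc m)"
    using assms by (metis Suc_le_D numeral_2_eq_2 Suc_le_mono)
  have "((\<lambda>t. (c * t + d * t\<^sup>2) * (x + t * h) ^ (n - 2)) has_integral F 1 - F 0) {0..1}"
  proof (rule fundamental_theorem_of_calculus)
    fix t :: real
    have G1: "(G1 has_real_derivative real n * (real n - 1) * (x + t * h) ^ (n - 2)) (at t within {0..1})"
      unfolding G1_def n using assms(2)
      by (auto intro!: derivative_eq_intros simp del: power_Suc) 
    have G2: "(G2 has_real_derivative G1 t) (at t within {0..1})"
      unfolding G1_def G2_def using assms(2)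
      by (auto intro!: derivative_eq_intros simp: power2_eq_square)
    have "((\<lambda>t. (x + t * h) ^ (n + 1)) has_real_derivative (real n + 1) * h * (x + t * h) ^ n)
        (at t within {0..1})"
      by (auto intro!: derivative_eq_intros simp del: power_Suc)
    from DERIV_cdivide[OF DERIV_cdivide[OF this, of "real n + 1"], of "h ^ 3"]
    have G3: "(G3 has_real_derivative G2 t) (at t within {0..1})"
      unfolding G2_def G3_def using assms(2) by (simp add: power2_eq_square power3_eq_cube)
    have k: "((\<lambda>t. c * t + d * t\<^sup>2) has_real_derivative c + 2 * d * t) (at t within {0..1})"
      and k': "((\<lambda>t. c + 2 * d * t) has_real_derivative 2 * d) (at t within {0..1})"
      by (auto intro!: derivative_eq_intros)
    have "((\<lambda>t. (c * t + d * t\<^sup>2) * G1 t - (c + 2 * d * t) * G2 t + 2 * d * G3 t)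
        has_real_derivative (c * t + d * t\<^sup>2) * (N * (x + t * h) ^ (n - 2))) (at t within {0..1})"
      by (rule DERIV_cong[OF DERIV_add[OF DERIV_diff[OF DERIV_mult[OF k G1] DERIV_mult[OF k' G2]]
              DERIV_cmult[OF G3, of "2 * d"]]])
        (simp add: N_def mult_ac)
    from DERIV_cdivide[OF this, of N]
    have "(F has_real_derivative (c * t + d * t\<^sup>2) * (x + t * h) ^ (n - 2)) (at t within {0..1})"
      unfolding F_def using \<open>N \<noteq> 0\<close> by simp
    then show "(F has_vector_derivative (c * t + d * t\<^sup>2) * (x + t * h) ^ (n - 2)) (at t within {0..1})"
      unfolding has_real_derivative_iff_has_vector_derivative .
  qed auto
  also have "F 1 - F 0 = ((c + d) * (real n * (x + h) ^ (n - 1)) / h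
      - ((c + 2 * d) * (x + h) ^ n - c * x ^ n) / h\<^sup>2
      + 2 * d * ((x + h) ^ (n + 1) - x ^ (n + 1)) / (real n + 1) / h ^ 3) / (real n * (real n - 1))"
    unfolding F_def G1_def G2_def G3_def N_def diff_divide_distrib[symmetric]
    by (rule arg_cong[where f = "\<lambda>z. z / _"]) (simp add: algebra_simps add_divide_distrib diff_divide_distrib)
  finally show ?thesis .
qed

text \<open>One estimate for all three rules: the pairs \<open>(c, d)\<close> = (0, 1), (2, -1) and
  (2, -3) give the midpoint, trapezoidal and Simpson errors, up to a factor.\<close>

lemma power_sum_error_bound:
  fixes a b c d N1 N2 :: real and n :: nat
  assumes "0 < a" "a < b" "n \<ge> 2"
    and N1: "integral {0..1} (\<lambda>t. t * \<bar>c + d * t\<bar> * (a + t * (b - a) / 2) ^ (n - 2)) \<le> N1"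
    and N2: "integral {0..1} (\<lambda>t. t * \<bar>c + d * t\<bar> * (b + t * (a - b) / 2) ^ (n - 2)) \<le> N2"
  shows "\<bar>2 * c * arith_mean (a ^ n) (b ^ n) - 2 * (c + 2 * d) * arith_mean a b ^ n
      + 4 * d * ((b ^ (n + 1) - a ^ (n + 1)) / (real (n + 1) * (b - a)))\<bar>
    \<le> real n * (real n - 1) * (b - a)\<^sup>2 / 4 * (N1 + N2)"
proof -
  define h where "h = (b - a) / 2"
  have h: "h > 0"
    using assms by (simp add: h_def)
  have mid: "a + h = arith_mean a b" "b + - h = arith_mean a b" and ba: "b - a = 2 * h"
    by (simp_all add: h_def arith_mean_def field_simps)
  have abs_le: "\<bar>I\<bar> \<le> N"
    if "((\<lambda>t. (c * t + d * t\<^sup>2) * (x + t * k) ^ (n - 2)) has_integral I) {0..1}"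
      and "integral {0..1} (\<lambda>t. t * \<bar>c + d * t\<bar> * (x + t * k) ^ (n - 2)) \<le> N"
      and pos: "\<And>t. t \<in> {0..1} \<Longrightarrow> x + t * k > 0" for I N x k
  proof -
    have "norm (integral {0..1} (\<lambda>t. (c * t + d * t\<^sup>2) * (x + t * k) ^ (n - 2)))
      \<le> integral {0..1} (\<lambda>t. t * \<bar>c + d * t\<bar> * (x + t * k) ^ (n - 2))"
    proof (rule integral_norm_bound_integral)
      fix t :: real assume t: "t \<in> {0..1}"
      have "c * t + d * t\<^sup>2 = t * (c + d * t)"
        by (simp add: algebra_simps power2_eq_square)
      then show "norm ((c * t + d * t\<^sup>2) * (x + t * k) ^ (n - 2)) \<le> t * \<bar>c + d * t\<bar> * (x + t * k) ^ (n - 2)"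
        using t pos[OF t] by (simp add: abs_mult)
    qed (auto intro!: integrable_continuous_interval continuous_intros)
    then show ?thesis
      using that by (simp add: integral_unique)
  qed
  define I where "I = (\<lambda>x k. ((c + d) * (real n * (x + k) ^ (n - 1)) / k
    - ((c + 2 * d) * (x + k) ^ n - c * x ^ n) / k\<^sup>2
    + 2 * d * ((x + k) ^ (n + 1) - x ^ (n + 1)) / (real n + 1) / k ^ 3) / (real n * (real n - 1)))"
  have "\<bar>I a h\<bar> \<le> N1"
  proof (rule abs_le)
    show "((\<lambda>t. (c * t + d * t\<^sup>2) * (a + t * h) ^ (n - 2)) has_integral I a h) {0..1}"
      unfolding I_def using assms h by (intro has_integral_quadratic_kernel) auto
  qed (use N1 chord_pos[of a b] assms in \<open>auto simp: h_def\<close>)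
  \<comment> \<open>The right half is traversed from \<open>b\<close> down to the midpoint, so the
    same formula applies with a negative step.\<close>
  moreover have "\<bar>I b (- h)\<bar> \<le> N2"
  proof (rule abs_le)
    show "((\<lambda>t. (c * t + d * t\<^sup>2) * (b + t * - h) ^ (n - 2)) has_integral I b (- h)) {0..1}"
      unfolding I_def using assms h by (intro has_integral_quadratic_kernel) auto
    have "t * (a - b) / 2 = t * - h" for t
      by (simp add: h_def field_simps)
    then show "integral {0..1} (\<lambda>t. t * \<bar>c + d * t\<bar> * (b + t * - h) ^ (n - 2)) \<le> N2"
      and "t \<in> {0..1} \<Longrightarrow> b + t * - h > 0" for t
      using N2 chord_pos[of b a t] assms by auto
  qed
  ultimately have "\<bar>I a h + I b (- h)\<bar> \<le> N1 + N2"
    by linarith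
  then have "real n * (real n - 1) * h\<^sup>2 * \<bar>I a h + I b (- h)\<bar> \<le> real n * (real n - 1) * h\<^sup>2 * (N1 + N2)"
    using assms by (intro mult_left_mono) auto
  moreover have "real n * (real n - 1) * h\<^sup>2 * (I a h + I b (- h)) =
      2 * c * arith_mean (a ^ n) (b ^ n) - 2 * (c + 2 * d) * arith_mean a b ^ n
      + 4 * d * ((b ^ (n + 1) - a ^ (n + 1)) / (real (n + 1) * (b - a)))"
  proof -
    define A where "A = arith_mean a b"
    have nz: "real n * (real n - 1) \<noteq> 0" "real n + 1 \<noteq> 0"
      using assms by auto
    have *: "N * (u / N + v / N) = u + v" if "N \<noteq> 0" for N u v :: real
      using that by (simp add: distrib_left)
    \<comment> \<open>The terms with the midpoint to the power \<open>n - 1\<close> carry the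
      factors \<open>1 / h\<close> and \<open>1 / (- h)\<close> and cancel between the two
      halves.\<close>
    have "real n * (real n - 1) * (I a h + I b (- h)) =
       (c * (a ^ n + b ^ n) - 2 * (c + 2 * d) * A ^ n) / h\<^sup>2
        + 2 * d * (b ^ (n + 1) - a ^ (n + 1)) / (real n + 1) / h ^ 3"
      unfolding I_def mid *[OF nz(1)] A_def[symmetric]
      by (simp add: algebra_simps add_divide_distrib diff_divide_distrib)
    then have "real n * (real n - 1) * h\<^sup>2 * (I a h + I b (- h)) =
       ((c * (a ^ n + b ^ n) - 2 * (c + 2 * d) * A ^ n) / h\<^sup>2
        + 2 * d * (b ^ (n + 1) - a ^ (n + 1)) / (real n + 1) / h ^ 3) * h\<^sup>2"
      by (simp add: mult_ac)
    also have "\<dots> = (c * (a ^ n + b ^ n) - 2 * (c + 2 * d) * A ^ n)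
        + 2 * d * (b ^ (n + 1) - a ^ (n + 1)) / (real n + 1) / h"
    proof -
      have "u / h ^ 3 * h\<^sup>2 = u / h" for u
        using h by (simp add: power2_eq_square power3_eq_cube)
      then show ?thesis
        using h by (simp only: distrib_right) simp
    qed
    also have "c * (a ^ n + b ^ n) = 2 * c * arith_mean (a ^ n) (b ^ n)"
      by (simp add: arith_mean_def)
    also have "2 * d * (b ^ (n + 1) - a ^ (n + 1)) / (real n + 1) / h
        = 4 * d * ((b ^ (n + 1) - a ^ (n + 1)) / (real (n + 1) * (b - a)))"
    proof -
      have "2 * d * u / v / h = 4 * d * (u / (v * (2 * h)))" for u v
        by (simp add: mult_ac)
      then show ?thesis
        unfolding ba by (simp only: of_nat_add of_nat_1)
    qed
    finally show ?thesis
      unfolding A_def .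
  qed
  moreover have "real n * (real n - 1) * h\<^sup>2 * \<bar>I a h + I b (- h)\<bar>
      = \<bar>real n * (real n - 1) * h\<^sup>2 * (I a h + I b (- h))\<bar>"
    using assms by (simp add: abs_mult)
  moreover have "real n * (real n - 1) * h\<^sup>2 = real n * (real n - 1) * (b - a)\<^sup>2 / 4"
    by (simp add: h_def power_divide)
  ultimately show ?thesis
    by metis
qed

section \<open>Conjugate exponents and the constants depending on them\<close>

lemma conjugate_exponent_cases:
  fixes q :: real and p :: ennreal
  assumes "q \<ge> 1" "1 / p + 1 / ennreal q = 1"
  obtains (top) "p = \<infinity>" "q = 1"
    | (real) r where "p = ennreal r" "r > 1" "q > 1" "1 / r + 1 / q = 1"
proof (cases p)
  case (real r)
  \<comment> \<open>At \<open>r = 0\<close> the summand \<open>1 / p\<close> would be infinite in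
    \<open>ennreal\<close>.\<close>
  have "r \<noteq> 0"
    using assms real by (auto simp: divide_ennreal_def)
  then have r: "r > 0" "1 / r + 1 / q = 1"
    using assms real conjugate_exponent_real_iff[of r q] by auto
  then have "q \<noteq> 1"
    by auto
  with assms have q: "q > 1"
    by simp
  have "1 / q > 0"
    using q by simp
  then have "1 / r < 1"
    using r(2) by linarith
  then have "r > 1"
    using r(1) by (simp add: field_simps)
  then show ?thesis
    using that(2)[of r] real r q by simp
next
  case top
  then have "ennreal (1 / q) = 1"
    using assms by (simp add: divide_ennreal flip: ennreal_1)
  then show ?thesis
    using that(1) top assms by (auto simp: ennreal_eq_1)
qed

lemma half_bound_powr:
  "half_bound q m x y powr (1 / q) =
    (1 / (2 * (q + 2))) powr (1 / q)
      * ((q + 3) / (q + 1) * x powr (real m * q) + y powr (real m * q)) powr (1 / q)"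
  unfolding half_bound_def by (rule powr_mult)

text \<open>Joins the two regimes: the limit of the \<open>r\<close>-norms of \<open>u\<close> is
  assumed to be the bound \<open>K\<close>, so one expression in \<open>p\<close> covers both
  Hoelder's inequality and its limiting case.\<close>

lemma at_exponent_half_bound:
  fixes x y q :: real and p :: ennreal and m :: nat
  assumes "x > 0" "y > 0" "q \<ge> 1" "m \<ge> 1" "1 / p + 1 / ennreal q = 1"
    and u: "continuous_on {0..1} u" "\<And>t. t \<in> {0..1} \<Longrightarrow> 0 \<le> u t \<and> u t \<le> K"
    and A: "\<And>r. r > 1 \<Longrightarrow> ((\<lambda>t. u t powr r) has_integral A r) {0..1}" "\<And>r. r > 1 \<Longrightarrow> A r > 0"
    and K: "at_exponent (\<lambda>r. A r powr (1 / r)) \<infinity> = K" "K \<ge> 0"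
  shows "integral {0..1} (\<lambda>t. t * u t * (x + t * (y - x) / 2) ^ m)
    \<le> at_exponent (\<lambda>r. A r powr (1 / r)) p * half_bound q m x y powr (1 / q)"
  using assms(3,5)
proof (cases rule: conjugate_exponent_cases)
  case top
  then show ?thesis
    using sup_half_bound[of x y m u K] half_bound_pos[of x y 1 m] assms by simp
next
  case (real r)
  then show ?thesis
    using Holder_half_bound[of x y r q m u "A r"] assms by (simp add: at_exponent_ennreal)
qed

lemma has_integral_two_minus_powr:
  fixes r :: real
  assumes "r > 1"
  shows "((\<lambda>t. (2 - t) powr r) has_integral (2 powr (r + 1) - 1) / (r + 1)) {0..1}"
proof -
  let ?F = "\<lambda>t::real. - ((2 - t) powr (r + 1) / (r + 1))"
  have "((\<lambda>t. (2 - t) powr r) has_integral ?F 1 - ?F 0) {0..1}"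
    using assms
    by (intro fundamental_theorem_of_calculus)
      (auto intro!: derivative_eq_intros simp flip: has_real_derivative_iff_has_vector_derivative)
  then show ?thesis
    by (simp add: diff_divide_distrib)
qed

text \<open>On \<open>[0, 1]\<close> the base \<open>2 - t\<close> is at least 1, so its
  \<open>r\<close>-th power dominates it. Integrating gives the lower bound 3/2, with no need to
  study the constant as a function of \<open>r\<close>.\<close>

lemma simpson_constant_ge:
  fixes r q :: real
  assumes "r > 1" "1 / r + 1 / q = 1"
  shows "(1 / 2) powr (1 - 1 / q) \<le> ((2 powr (r + 1) - 1) / (3 * (r + 1))) powr (1 / r)"
proof -
  have "((\<lambda>t. 2 - t) has_integral 3 / 2) {0..1::real}"
  proof -
    let ?F = "\<lambda>t::real. 2 * t - t\<^sup>2 / 2"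
    have "((\<lambda>t. 2 - t) has_integral ?F 1 - ?F 0) {0..1}"
      by (intro fundamental_theorem_of_calculus)
        (auto intro!: derivative_eq_intros simp flip: has_real_derivative_iff_has_vector_derivative)
    then show ?thesis
      by simp
  qed
  then have "3 / 2 \<le> (2 powr (r + 1) - 1) / (r + 1)"
  proof (rule has_integral_le[OF _ has_integral_two_minus_powr])
    fix t :: real assume "t \<in> {0..1}"
    then show "2 - t \<le> (2 - t) powr r"
      using powr_mono[of 1 r "2 - t"] assms by simp
  qed fact
  then have "1 / 2 \<le> (2 powr (r + 1) - 1) / (3 * (r + 1))"
    using assms by (simp add: field_simps)
  moreover have "1 - 1 / q = 1 / r"
    using assms by simp
  ultimately show ?thesis
    using assms by (simp only:) (intro powr_mono2, auto)
qed

section \<open>The three inequalities from the three kernels\<close>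

theorem proposition6:
  fixes a b q S :: real and p :: ennreal and n :: nat
  assumes "0 < a" and "a < b"
    and "q \<ge> 1"
    and "1 / p + 1 / ennreal q = 1"
    and "n > 2"
    and S_def: "S = (\<Sum>i::nat = 1..2.
           (((q + 3) / (q + 1)) ^ (i - 1) * b powr ((real n - 2) * q)
          + ((q + 3) / (q + 1)) ^ (2 - i) * a powr ((real n - 2) * q)) powr (1 / q))"
  shows "\<bar>arith_mean a b ^ n - log_mean n a b ^ n\<bar>
           \<le> real n * (real n - 1) * (b - a)\<^sup>2 / 16
             * at_exponent (\<lambda>p. (1 / (p + 1)) powr (1 / p)) p
             * (1 / (2 * (q + 2))) powr (1 / q) * S
       \<and> \<bar>arith_mean (a ^ n) (b ^ n) - log_mean n a b ^ n\<bar>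
           \<le> real n * (real n - 1) * (b - a)\<^sup>2 / 16
             * at_exponent (\<lambda>p. ((2 powr (p + 1) - 1) / (p + 1)) powr (1 / p)) p
             * (1 / (2 * (q + 2))) powr (1 / q) * S
       \<and> \<bar>1 / 3 * arith_mean (a ^ n) (b ^ n) + 2 / 3 * arith_mean a b ^ n - log_mean n a b ^ n\<bar>
           \<le> real n * (real n - 1) * (b - a)\<^sup>2 / 48
             * at_exponent (\<lambda>p. ((2 powr (p + 1) - 1) / (3 * (p + 1))) powr (1 / p)) p
             * (1 / (2 * (q + 2))) powr (1 / q) * S"
proof -
  define m where "m = n - 2"
  have m: "m \<ge> 1" "real m = real n - 2" "n - 2 = m"
    using assms by (auto simp: m_def)
  define V where "V = (b ^ (n + 1) - a ^ (n + 1)) / (real (n + 1) * (b - a))"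
  have "a ^ (n + 1) < b ^ (n + 1)"
    using assms by (intro power_strict_mono) auto
  then have "V > 0"
    unfolding V_def using assms by (intro divide_pos_pos mult_pos_pos) auto
  \<comment> \<open>Positivity of the mean value \<open>V\<close> lets the \<open>n\<close>-th power
    undo the root in \<open>log_mean\<close>.\<close>
  then have "(V powr (1 / real n)) ^ n = V"
    using assms by (simp add: powr_powr flip: powr_realpow)
  then have V: "log_mean n a b ^ n = V"
    by (simp only: log_mean_def V_def)
  define D where "D = (1 / (2 * (q + 2))) powr (1 / q)"
  \<comment> \<open>The half starting at \<open>a\<close> yields the summand \<open>i = 1\<close> of
    \<open>S\<close>, the half starting at \<open>b\<close> the summand
    \<open>i = 2\<close>.\<close>
  have S: "half_bound q m a b powr (1 / q) + half_bound q m b a powr (1 / q) = D * S"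
    unfolding half_bound_powr S_def D_def[symmetric] m(2)
    by (simp add: eval_nat_numeral algebra_simps)
  define c where "c = real n * (real n - 1) * (b - a)\<^sup>2"
  have error: "\<bar>2 * k * arith_mean (a ^ n) (b ^ n) - 2 * (k + 2 * l) * arith_mean a b ^ n + 4 * l * V\<bar>
      \<le> c / 4 * (C * (D * S))"
    if "\<And>x y. x > 0 \<Longrightarrow> y > 0 \<Longrightarrow> integral {0..1} (\<lambda>t. t * \<bar>k + l * t\<bar> * (x + t * (y - x) / 2) ^ m)
      \<le> C * half_bound q m x y powr (1 / q)" for k l C
  proof -
    have "\<bar>2 * k * arith_mean (a ^ n) (b ^ n) - 2 * (k + 2 * l) * arith_mean a b ^ n + 4 * l * V\<bar>
        \<le> c / 4 * (C * half_bound q m a b powr (1 / q) + C * half_bound q m b a powr (1 / q))"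
      unfolding V_def c_def
    proof (rule power_sum_error_bound)
      show "integral {0..1} (\<lambda>t. t * \<bar>k + l * t\<bar> * (a + t * (b - a) / 2) ^ (n - 2))
          \<le> C * half_bound q m a b powr (1 / q)"
        "integral {0..1} (\<lambda>t. t * \<bar>k + l * t\<bar> * (b + t * (a - b) / 2) ^ (n - 2))
          \<le> C * half_bound q m b a powr (1 / q)"
        unfolding m(3) using assms by (intro that; simp)+
    qed (use assms in auto)
    then show ?thesis
      by (simp only: S flip: distrib_left)
  qed
  let ?C1 = "at_exponent (\<lambda>p. (1 / (p + 1)) powr (1 / p)) p"
  let ?C2 = "at_exponent (\<lambda>p. ((2 powr (p + 1) - 1) / (p + 1)) powr (1 / p)) p"
  let ?C3 = "at_exponent (\<lambda>p. ((2 powr (p + 1) - 1) / (3 * (p + 1))) powr (1 / p)) p"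
  \<comment> \<open>Midpoint rule; the unsimplified \<open>0 + 1 * t\<close> matches the shape
    \<open>k + l * t\<close> in \<open>error\<close>.\<close>
  have "integral {0..1} (\<lambda>t. t * \<bar>0 + 1 * t\<bar> * (x + t * (y - x) / 2) ^ m)
      \<le> ?C1 * half_bound q m x y powr (1 / q)" if "x > 0" "y > 0" for x y
  proof (rule at_exponent_half_bound[where K = 1 and u = "\<lambda>t. \<bar>0 + 1 * t\<bar>"])
    fix r :: real assume "r > 1"
    then have "((\<lambda>t. t powr r) has_integral 1 / (r + 1)) {0..1}"
      using has_integral_powr_from_0[of r 1] by simp
    then show "((\<lambda>t. \<bar>0 + 1 * t\<bar> powr r) has_integral 1 / (r + 1)) {0..1}"
      by (rule has_integral_eq[rotated]) auto
  qed (use that assms m at_exponent_top_values in \<open>auto intro!: continuous_intros\<close>)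
  note 1 = error[of 0 1, OF this]
  have "integral {0..1} (\<lambda>t. t * \<bar>2 + - 1 * t\<bar> * (x + t * (y - x) / 2) ^ m)
      \<le> ?C2 * half_bound q m x y powr (1 / q)" if "x > 0" "y > 0" for x y
  proof (rule at_exponent_half_bound[where K = 2 and u = "\<lambda>t. \<bar>2 + - 1 * t\<bar>"])
    fix r :: real assume "r > 1"
    from has_integral_two_minus_powr[OF this]
    show "((\<lambda>t. \<bar>2 + - 1 * t\<bar> powr r) has_integral (2 powr (r + 1) - 1) / (r + 1)) {0..1}"
      by (rule has_integral_eq[rotated]) auto
  next
    fix r :: real assume "r > 1"
    then show "(2 powr (r + 1) - 1) / (r + 1) > 0"
      by (intro divide_pos_pos) (auto intro!: gr_one_powr)
  qed (use that assms m at_exponent_top_values in \<open>auto intro!: continuous_intros\<close>)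
  note 2 = error[of 2 "- 1", OF this]
  \<comment> \<open>For \<open>q = 1\<close> the left side is 1 and the limiting constant is
    2.\<close>
  have "(1 / 2) powr (1 - 1 / q) \<le> ?C3"
    using assms(3,4)
  proof (cases rule: conjugate_exponent_cases)
    case top
    then show ?thesis
      using at_exponent_top_values(3) by simp
  next
    case (real r)
    then show ?thesis
      using simpson_constant_ge[of r q] by (simp add: at_exponent_ennreal)
  qed
  then have "integral {0..1} (\<lambda>t. t * \<bar>2 + - 3 * t\<bar> * (x + t * (y - x) / 2) ^ m)
      \<le> ?C3 * half_bound q m x y powr (1 / q)" if "x > 0" "y > 0" for x y
    using simpson_half_bound[of x y q m ?C3] that assms m by simp
  note 3 = error[of 2 "- 3", OF this]
  \<comment> \<open>The combinations bounded in \<open>1\<close>, \<open>2\<close> and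
    \<open>3\<close> are -4, 4 and 12 times the errors sought, which turns \<open>c / 4\<close> into
    \<open>c / 16\<close>, \<open>c / 16\<close> and \<open>c / 48\<close>.\<close>
  have cancel: "\<bar>z\<bar> \<le> c / (4 * k) * C * D * S"
    if "\<bar>z'\<bar> \<le> c / 4 * (C * (D * S))" "z' = k * z \<or> z' = - (k * z)" "k > 0" for z z' k C
    using that by (auto simp: abs_mult field_simps)
  show ?thesis
  proof (intro conjI)
    show "\<bar>arith_mean a b ^ n - log_mean n a b ^ n\<bar>
           \<le> real n * (real n - 1) * (b - a)\<^sup>2 / 16 * ?C1 * (1 / (2 * (q + 2))) powr (1 / q) * S"
      using cancel[OF 1, of 4] unfolding V D_def[symmetric] c_def[symmetric] by simp
    show "\<bar>arith_mean (a ^ n) (b ^ n) - log_mean n a b ^ n\<bar>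
           \<le> real n * (real n - 1) * (b - a)\<^sup>2 / 16 * ?C2 * (1 / (2 * (q + 2))) powr (1 / q) * S"
      using cancel[OF 2, of 4] unfolding V D_def[symmetric] c_def[symmetric] by simp
    show "\<bar>1 / 3 * arith_mean (a ^ n) (b ^ n) + 2 / 3 * arith_mean a b ^ n - log_mean n a b ^ n\<bar>
           \<le> real n * (real n - 1) * (b - a)\<^sup>2 / 48 * ?C3 * (1 / (2 * (q + 2))) powr (1 / q) * S"
      using cancel[OF 3, of 12] unfolding V D_def[symmetric] c_def[symmetric] by simp
  qed
qed

end
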